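(* A finite connected multigraph $G=(V,E)$ without self-loops and with at least one edge is homogeneous if and only if for every feasible partition $P$ of $G$ with $k_P$ parts, $$\frac{|E_P|}{k_P-1}\ge\frac{|E|}{|V|-1}.$$
   Context: $\Gamma_G$ is the set of spanning trees of $G$ (as subsets of $E$), $\mathcal{P}(\Gamma_G)$ the set of probability mass functions (pmfs) on it. A pmf is optimal if it minimizes $\sum_{\gamma,\gamma'\in\Gamma_G}|\gamma\cap\gamma'|\,\mu(\gamma)\mu(\gamma')$ over $\mu\in\mathcal{P}(\Gamma_G)$. The edge usage probabilities $\eta^*(e)=\sum_{\gamma\ni e}\mu^*(\gamma)$ are the same for every optimal $\mu^*$; $G$ is homogeneous if $\eta^*$ is constant on $E$. A feasible partition $P$ of $G$ is a partition $\{V_1,\dots,V_{k_P}\}$ of $V$ into $k_P\ge2$ (nonempty) parts such that each induced subgraph $G(V_i)$ is connected; $E_P$ is the set of edges of $G$ connecting vertices in different parts. *)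

theory Defs
  imports "HOL-Probability.Probability"
begin

text \<open>
  Edges are abstract objects carrying a set of endpoints, so distinct edges may be parallel, and
  spanning trees are sets of edges rather than sets of vertex pairs. Every edge having exactly two
  endpoints excludes self-loops.
\<close>

record ('v, 'e) multigraph =
  verts :: "'v set"
  edges :: "'e set"
  ends :: "'e \<Rightarrow> 'v set"

definition finite_loopfree :: "('v, 'e) multigraph \<Rightarrow> bool" where
  "finite_loopfree G \<longleftrightarrow> finite (verts G) \<and> finite (edges G) \<and>
     (\<forall>e\<in>edges G. ends G e \<subseteq> verts G \<and> card (ends G e) = 2)"

definition adj :: "('v, 'e) multigraph \<Rightarrow> ('v \<times> 'v) set" where
  "adj G = {(u, v). \<exists>e\<in>edges G. ends G e = {u, v}}"

definition connected_graph :: "('v, 'e) multigraph \<Rightarrow> bool" where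
  "connected_graph G \<longleftrightarrow> verts G \<noteq> {} \<and> (\<forall>u\<in>verts G. \<forall>v\<in>verts G. (u, v) \<in> (adj G)\<^sup>*)"

text \<open>
  The cycle \<open>vs ! 0, es ! 0, vs ! 1, es ! 1, \<dots>\<close> closes up after \<open>length vs\<close> steps.
  Two parallel edges form a cycle of length two; a single edge does not, because the edges of a
  cycle have to be distinct.
\<close>

definition is_cycle :: "('v, 'e) multigraph \<Rightarrow> 'v list \<Rightarrow> 'e list \<Rightarrow> bool" where
  "is_cycle G vs es \<longleftrightarrow>
     vs \<noteq> [] \<and> length es = length vs \<and> distinct vs \<and> distinct es \<and> set es \<subseteq> edges G \<and>
     (\<forall>i<length vs. ends G (es ! i) = {vs ! i, vs ! (Suc i mod length vs)})"

definition is_tree :: "('v, 'e) multigraph \<Rightarrow> bool" where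
  "is_tree G \<longleftrightarrow> connected_graph G \<and> \<not> (\<exists>vs es. is_cycle G vs es)"

definition spanning_trees :: "('v, 'e) multigraph \<Rightarrow> 'e set set" where
  "spanning_trees G = {\<gamma>. \<gamma> \<subseteq> edges G \<and> is_tree (G\<lparr>edges := \<gamma>\<rparr>)}"

definition tree_pmfs :: "('v, 'e) multigraph \<Rightarrow> 'e set pmf set" where
  "tree_pmfs G = {\<mu>. set_pmf \<mu> \<subseteq> spanning_trees G}"

definition expected_overlap :: "('v, 'e) multigraph \<Rightarrow> 'e set pmf \<Rightarrow> real" where
  "expected_overlap G \<mu> =
     (\<Sum>\<gamma>\<in>spanning_trees G. \<Sum>\<gamma>'\<in>spanning_trees G. real (card (\<gamma> \<inter> \<gamma>')) * pmf \<mu> \<gamma> * pmf \<mu> \<gamma>')"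

definition optimal_pmf :: "('v, 'e) multigraph \<Rightarrow> 'e set pmf \<Rightarrow> bool" where
  "optimal_pmf G \<mu> \<longleftrightarrow> \<mu> \<in> tree_pmfs G \<and>
     (\<forall>\<nu>\<in>tree_pmfs G. expected_overlap G \<mu> \<le> expected_overlap G \<nu>)"

definition edge_usage :: "('v, 'e) multigraph \<Rightarrow> 'e set pmf \<Rightarrow> 'e \<Rightarrow> real" where
  "edge_usage G \<mu> e = (\<Sum>\<gamma> | \<gamma> \<in> spanning_trees G \<and> e \<in> \<gamma>. pmf \<mu> \<gamma>)"

text \<open>
  By \<open>edge_usage_optimal_unique\<close> below, which optimal pmf is chosen is irrelevant; the
  existential quantifier keeps the property from holding vacuously.
\<close>

definition homogeneous :: "('v, 'e) multigraph \<Rightarrow> bool" where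
  "homogeneous G \<longleftrightarrow> (\<exists>\<mu>. optimal_pmf G \<mu> \<and> (\<exists>c. \<forall>e\<in>edges G. edge_usage G \<mu> e = c))"

definition induced_subgraph :: "('v, 'e) multigraph \<Rightarrow> 'v set \<Rightarrow> ('v, 'e) multigraph" where
  "induced_subgraph G U = G\<lparr>verts := U, edges := {e \<in> edges G. ends G e \<subseteq> U}\<rparr>"

definition feasible_partition :: "('v, 'e) multigraph \<Rightarrow> 'v set set \<Rightarrow> bool" where
  "feasible_partition G P \<longleftrightarrow> partition_on (verts G) P \<and> card P \<ge> 2 \<and>
     (\<forall>U\<in>P. connected_graph (induced_subgraph G U))"

definition cut_edges :: "('v, 'e) multigraph \<Rightarrow> 'v set set \<Rightarrow> 'e set" where
  "cut_edges G P = {e \<in> edges G. \<exists>A\<in>P. \<exists>B\<in>P. A \<noteq> B \<and> (\<exists>u\<in>A. \<exists>v\<in>B. ends G e = {u, v})}"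

lemma expected_overlap_eq_sum_squares:
  assumes "finite (edges G)"
  shows "expected_overlap G \<mu> = (\<Sum>e\<in>edges G. (edge_usage G \<mu> e)\<^sup>2)"
proof -
  let ?T = "spanning_trees G" and ?E = "edges G"
  have fT: "finite ?T"
    by (rule finite_subset[of _ "Pow ?E"]) (auto simp: spanning_trees_def assms)
  have usage: "edge_usage G \<mu> e = (\<Sum>\<gamma>\<in>?T. if e \<in> \<gamma> then pmf \<mu> \<gamma> else 0)" for e
    unfolding edge_usage_def using fT by (simp add: sum.inter_filter)
  have overlap: "real (card (\<gamma> \<inter> \<gamma>')) = (\<Sum>e\<in>?E. if e \<in> \<gamma> \<and> e \<in> \<gamma>' then 1 else 0)"
    if "\<gamma> \<in> ?T" for \<gamma> \<gamma>'
  proof -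
    have "\<gamma> \<inter> \<gamma>' = {e \<in> ?E. e \<in> \<gamma> \<and> e \<in> \<gamma>'}" using that by (auto simp: spanning_trees_def)
    then show ?thesis using assms by (simp add: sum.inter_filter[symmetric])
  qed
  have "expected_overlap G \<mu> =
      (\<Sum>\<gamma>\<in>?T. \<Sum>\<gamma>'\<in>?T. \<Sum>e\<in>?E.
        (if e \<in> \<gamma> then pmf \<mu> \<gamma> else 0) * (if e \<in> \<gamma>' then pmf \<mu> \<gamma>' else 0))"
    unfolding expected_overlap_def
    by (intro sum.cong refl) (simp add: overlap sum_distrib_right, intro sum.cong refl, simp)
  also have "\<dots> = (\<Sum>e\<in>?E. \<Sum>\<gamma>\<in>?T. \<Sum>\<gamma>'\<in>?T.
        (if e \<in> \<gamma> then pmf \<mu> \<gamma> else 0) * (if e \<in> \<gamma>' then pmf \<mu> \<gamma>' else 0))"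
    unfolding sum.swap[of _ ?E ?T] by (rule refl)
  also have "\<dots> = (\<Sum>e\<in>?E. (edge_usage G \<mu> e)\<^sup>2)"
    by (simp add: usage power2_eq_square sum_product)
  finally show ?thesis .
qed

lemma edge_usage_optimal_unique:
  assumes "finite (edges G)" "optimal_pmf G \<mu>" "optimal_pmf G \<nu>" "e \<in> edges G"
  shows "edge_usage G \<mu> e = edge_usage G \<nu> e"
proof -
  define \<rho> where "\<rho> = bind_pmf (bernoulli_pmf (1/2)) (\<lambda>b. if b then \<mu> else \<nu>)"
  have pmf: "pmf \<rho> \<gamma> = (pmf \<mu> \<gamma> + pmf \<nu> \<gamma>) / 2" for \<gamma>
    by (simp add: \<rho>_def pmf_bind field_simps)
  have "\<rho> \<in> tree_pmfs G"
    using assms(2,3) by (auto simp: \<rho>_def tree_pmfs_def optimal_pmf_def split: if_splits)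
  then have le: "expected_overlap G \<mu> \<le> expected_overlap G \<rho>"
    and eq: "expected_overlap G \<mu> = expected_overlap G \<nu>"
    using assms(2,3) by (auto simp: optimal_pmf_def intro: antisym)
  have usage: "edge_usage G \<rho> f = (edge_usage G \<mu> f + edge_usage G \<nu> f) / 2" for f
    by (simp add: edge_usage_def pmf sum.distrib flip: sum_divide_distrib)
  have "(\<Sum>f\<in>edges G. (edge_usage G \<mu> f - edge_usage G \<nu> f)\<^sup>2)
      = 2 * expected_overlap G \<mu> + 2 * expected_overlap G \<nu> - 4 * expected_overlap G \<rho>"
    unfolding expected_overlap_eq_sum_squares[OF assms(1)] usage sum_distrib_left
      sum.distrib[symmetric] sum_subtractf[symmetric]
    by (intro sum.cong refl) (simp add: power2_eq_square field_simps)
  also have "\<dots> \<le> 0" using le eq by simp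
  finally have "(\<Sum>f\<in>edges G. (edge_usage G \<mu> f - edge_usage G \<nu> f)\<^sup>2) = 0"
    by (intro antisym sum_nonneg) auto
  then show ?thesis using assms(1,4) by (simp add: sum_nonneg_eq_0_iff)
qed

end

theory Submission
  imports Defs
begin

text \<open>
  Write \<open>n\<close>, \<open>m\<close> for the numbers of vertices and edges and \<open>\<eta>\<close> for the edge usage of a pmf \<open>\<mu>\<close> on
  spanning trees. Every spanning tree has \<open>n - 1\<close> edges, so the values \<open>\<eta> e\<close> always add up to
  \<open>n - 1\<close>.

  If \<open>\<eta>\<close> is constant, its value is \<open>(n - 1) / m\<close>. A spanning tree stays connected when the \<open>k\<close> parts
  of a partition are contracted, so it uses at least \<open>k - 1\<close> cut edges
  (\<open>spanning_tree_crosses\<close>). Averaging over \<open>\<mu>\<close> gives \<open>|E_P| (n - 1) / m \<ge> k - 1\<close>, which is the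
  claimed bound (\<open>homogeneous_imp_cut_bound\<close>).

  Conversely, let \<open>\<mu>\<close> be optimal, which is possible by compactness (\<open>optimal_pmf_exists\<close>). The expected
  overlap is the sum of the squares of the usages, with gradient \<open>2 \<eta>\<close>. Moving mass from a
  tree in the support of \<open>\<mu>\<close> to another tree cannot decrease it, so every tree in the support is a
  minimum-weight spanning tree for the weights \<open>\<eta>\<close> (\<open>optimal_support_minimal\<close>). Suppose \<open>\<eta>\<close> is
  not constant, with maximum \<open>M\<close>, and let \<open>L\<close> be the set of edges with \<open>\<eta> e < M\<close>. By the exchange property,
  the part in \<open>L\<close> of a minimum-weight tree already spans the components of \<open>(V, L)\<close>
  (\<open>optimal_support_links_light_edges\<close>), so if there are \<open>k\<close> such components, the tree uses at most
  \<open>k - 1\<close> edges of \<open>E - L\<close>. Averaging gives \<open>M |E - L| \<le> k - 1\<close> (\<open>heavy_edges_usage\<close>).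
  The components of \<open>(V, L)\<close> form a feasible partition whose cut edges lie in \<open>E - L\<close>, while
  \<open>M m > n - 1\<close> because \<open>\<eta>\<close> is not constant. Hence its ratio is at most \<open>1 / M < m / (n - 1)\<close>, and
  the cut bound fails (\<open>cut_bound_imp_homogeneous\<close>).

  The combinatorics of spanning trees is reduced to counting components: adding an edge either leaves
  the component count unchanged or lowers it by one. A set of edges is therefore a spanning tree iff
  it is connected and has \<open>n - 1\<close> elements (\<open>spanning_tree_iff\<close>), which is how replacing one edge
  of a tree by another is seen to give a tree.
\<close>

section \<open>Components of a set of edges\<close>

locale finite_multigraph =
  fixes G :: "('v, 'e) multigraph"
  assumes loopfree: "finite_loopfree G"
begin

lemma finite_verts: "finite (verts G)" and finite_edges: "finite (edges G)"
  using loopfree by (auto simp: finite_loopfree_def)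

lemma edge_ends:
  assumes "e \<in> edges G"
  obtains a b where "ends G e = {a, b}" "a \<noteq> b" "a \<in> verts G" "b \<in> verts G"
  using loopfree assms unfolding finite_loopfree_def by (metis card_2_iff insert_subset)

definition linked :: "'e set \<Rightarrow> ('v \<times> 'v) set" where
  "linked F = (adj (G\<lparr>edges := F\<rparr>))\<^sup>*"

definition components :: "'e set \<Rightarrow> 'v set set" where
  "components F = (\<lambda>v. linked F `` {v}) ` verts G"

lemma adj_edges_iff: "(u, v) \<in> adj (G\<lparr>edges := F\<rparr>) \<longleftrightarrow> (\<exists>e\<in>F. ends G e = {u, v})"
  by (simp add: adj_def)

lemma linked_refl: "(u, u) \<in> linked F"
  by (simp add: linked_def)

lemma linked_sym: "(u, v) \<in> linked F \<Longrightarrow> (v, u) \<in> linked F"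
  unfolding linked_def
  by (rule symD[OF sym_rtrancl]) (auto simp: sym_def adj_edges_iff insert_commute)

lemma linked_trans: "(u, v) \<in> linked F \<Longrightarrow> (v, w) \<in> linked F \<Longrightarrow> (u, w) \<in> linked F"
  unfolding linked_def by (rule rtrancl_trans)

lemma linked_edge: "e \<in> F \<Longrightarrow> ends G e = {u, v} \<Longrightarrow> (u, v) \<in> linked F"
  unfolding linked_def by (rule r_into_rtrancl) (auto simp: adj_edges_iff)

text \<open>
  The relation \<open>linked H\<close> is reflexive and transitive, so it contains the closure of any set of steps it contains.
\<close>

lemma linked_subsetI:
  assumes "\<And>e u v. e \<in> F \<Longrightarrow> ends G e = {u, v} \<Longrightarrow> (u, v) \<in> linked H"
  shows "linked F \<subseteq> linked H"
proof -
  have "adj (G\<lparr>edges := F\<rparr>) \<subseteq> linked H" using assms by (auto simp: adj_edges_iff)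
  then show ?thesis
    using rtrancl_mono[of "adj (G\<lparr>edges := F\<rparr>)" "linked H"] by (simp add: linked_def)
qed

lemma linked_mono: "F \<subseteq> H \<Longrightarrow> linked F \<subseteq> linked H"
  by (rule linked_subsetI) (auto intro: linked_edge)

lemma linked_verts: 
  assumes "(u, v) \<in> linked F" "F \<subseteq> edges G" "u \<in> verts G"
  shows "v \<in> verts G"
  using assms unfolding linked_def
proof (induction rule: rtrancl_induct)
  case (step y z)
  then obtain e where "e \<in> edges G" "ends G e = {y, z}" by (auto simp: adj_edges_iff)
  then show ?case by (metis edge_ends insertCI singletonD insertE)
qed

lemma connected_iff_linked:
  "connected_graph (G\<lparr>edges := F\<rparr>) \<longleftrightarrow>
     verts G \<noteq> {} \<and> (\<forall>u\<in>verts G. \<forall>v\<in>verts G. (u, v) \<in> linked F)"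
  by (simp add: connected_graph_def linked_def)

lemma connected_transfer:
  "connected_graph (G\<lparr>edges := F\<rparr>) \<Longrightarrow> linked F \<subseteq> linked H \<Longrightarrow> connected_graph (G\<lparr>edges := H\<rparr>)"
  by (auto simp: connected_iff_linked)

lemma linked_class_eq: "(u, v) \<in> linked F \<Longrightarrow> linked F `` {u} = linked F `` {v}"
  by (auto intro: linked_trans linked_sym)

text \<open>
  The classes of the two ends of the new edge merge, and no other class changes: the right-hand side is
  stable under appending a step along an edge of \<open>insert e F\<close>.
\<close>

lemma linked_insert:
  fixes F :: "'e set"
  assumes "ends G e = {a, b}"
  defines "K \<equiv> linked F `` {a} \<union> linked F `` {b}"
  shows "linked (insert e F) = linked F \<union> K \<times> K"
proof
  have ab: "(a, b) \<in> linked (insert e F)" by (rule linked_edge[OF _ assms(1)]) simp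
  have sub: "linked F \<subseteq> linked (insert e F)" by (rule linked_mono) auto
  have K: "(a, x) \<in> linked (insert e F)" if "x \<in> K" for x
    using that ab sub unfolding K_def by (auto intro: linked_trans)
  show "linked F \<union> K \<times> K \<subseteq> linked (insert e F)"
    using sub K by (blast intro: linked_trans linked_sym)
  show "linked (insert e F) \<subseteq> linked F \<union> K \<times> K"
  proof (rule subrelI)
    fix x y assume "(x, y) \<in> linked (insert e F)"
    then show "(x, y) \<in> linked F \<union> K \<times> K"
      unfolding linked_def[of "insert e F"]
    proof (induction rule: rtrancl_induct)
      case base then show ?case by (simp add: linked_refl)
    next
      case (step y z)
      have "(y, z) \<in> linked F \<or> {y, z} = {a, b}"
        using step.hyps(2) assms(1) by (auto simp: adj_edges_iff intro: linked_edge)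
      then show ?case
      proof
        assume "(y, z) \<in> linked F"
        then show ?thesis using step.IH unfolding K_def by (auto intro: linked_trans)
      next
        assume "{y, z} = {a, b}"
        then have "y = a \<and> z = b \<or> y = b \<and> z = a" by (auto simp: doubleton_eq_iff)
        then show ?thesis
          using step.IH unfolding K_def by (auto intro: linked_sym linked_refl)
      qed
    qed
  qed
qed

lemma finite_components: "finite (components F)"
  by (simp add: components_def finite_verts)

lemma components_insert:
  fixes F :: "'e set"
  assumes "ends G e = {a, b}" "a \<in> verts G" "b \<in> verts G"
  defines "A \<equiv> linked F `` {a}" and "B \<equiv> linked F `` {b}"
  shows "components (insert e F) = insert (A \<union> B) (components F - {A, B})"
proof -
  have cls: "linked (insert e F) `` {v} = (if v \<in> A \<union> B then A \<union> B else linked F `` {v})" for v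
    unfolding linked_insert[OF assms(1)] A_def B_def
    by (auto intro: linked_trans linked_sym)
  have in_cls: "linked F `` {v} \<in> {A, B} \<longleftrightarrow> v \<in> A \<union> B" for v
    unfolding A_def B_def using linked_class_eq[of a v F] linked_class_eq[of b v F]
      linked_refl[of v F] by auto
  have "components (insert e F) =
      (\<lambda>v. if v \<in> A \<union> B then A \<union> B else linked F `` {v}) ` verts G"
    unfolding components_def cls ..
  also have "\<dots> = insert (A \<union> B) ((\<lambda>v. linked F `` {v}) ` {v \<in> verts G. v \<notin> A \<union> B})"
    using assms(2) linked_refl[of a F] unfolding A_def by (auto simp: image_iff)
  also have "(\<lambda>v. linked F `` {v}) ` {v \<in> verts G. v \<notin> A \<union> B} = components F - {A, B}"
    unfolding components_def using in_cls by auto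
  finally show ?thesis .
qed

text \<open>
  If the ends of \<open>e\<close> are already linked, the two classes removed in \<open>components_insert\<close> are one and
  the same, and the class inserted is that class again; otherwise two classes are replaced by one.
\<close>

lemma card_components_insert:
  assumes "e \<in> edges G" "ends G e = {a, b}"
  shows "card (components F) =
    card (components (insert e F)) + (if (a, b) \<in> linked F then 0 else 1)"
proof -
  have V: "a \<in> verts G" "b \<in> verts G"
    using assms by (metis edge_ends insertCI insertE singletonD)+
  let ?A = "linked F `` {a}" and ?B = "linked F `` {b}"
  have mem: "?A \<in> components F" "?B \<in> components F" using V by (auto simp: components_def)
  have new: "?A \<union> ?B \<notin> components F - {?A, ?B}"
  proof
    assume *: "?A \<union> ?B \<in> components F - {?A, ?B}"
    then obtain v where v: "?A \<union> ?B = linked F `` {v}" by (auto simp: components_def)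
    then have "(v, a) \<in> linked F" using linked_refl[of a F] by auto
    then have "linked F `` {v} = ?A" by (rule linked_class_eq)
    with v * show False by simp
  qed
  have card: "card (components (insert e F)) = Suc (card (components F - {?A, ?B}))"
    unfolding components_insert[OF assms(2) V] using new finite_components by simp
  have "card (components F - {?A, ?B}) = card (components F) - card {?A, ?B}"
    using mem by (intro card_Diff_subset) auto
  moreover have "card {?A, ?B} \<le> card (components F)"
    using mem by (intro card_mono finite_components) auto
  moreover have "?A = ?B \<longleftrightarrow> (a, b) \<in> linked F"
    using linked_class_eq[of a b F] linked_refl[of b F] by auto
  moreover have "card {?A, ?B} = (if ?A = ?B then 1 else 2)" by simp
  ultimately show ?thesis using card by (simp split: if_splits)
qed

lemma card_components_le_insert:
  assumes "e \<in> edges G"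
  shows "card (components F) \<le> Suc (card (components (insert e F)))"
proof -
  obtain a b where "ends G e = {a, b}" using assms by (rule edge_ends)
  then show ?thesis using card_components_insert[OF assms, of a b F] by simp
qed

lemma card_components_le_union:
  assumes "D \<subseteq> edges G"
  shows "card (components F) \<le> card (components (F \<union> D)) + card D"
proof -
  have "finite D" using assms finite_edges finite_subset by blast
  then show ?thesis using assms
  proof (induction D rule: finite_induct)
    case (insert e D)
    then show ?case using card_components_le_insert[of e "F \<union> D"] by simp
  qed simp
qed

lemma card_components_empty: "card (components {}) = card (verts G)"
proof -
  have "linked {} = Id" by (simp add: linked_def adj_def)
  then show ?thesis unfolding components_def by (intro card_image) (auto simp: inj_on_def)
qed

text \<open>
  Without edges there are as many components as vertices, and each edge removes at most one.
\<close>

lemma card_verts_le: "F \<subseteq> edges G \<Longrightarrow> card (verts G) \<le> card (components F) + card F"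
  using card_components_le_union[of F "{}"] by (simp add: card_components_empty)

lemma card_components_connected:
  assumes "connected_graph (G\<lparr>edges := F\<rparr>)"
  shows "card (components F) = 1"
proof -
  obtain v where v: "v \<in> verts G" using assms by (auto simp: connected_iff_linked)
  have "components F = {linked F `` {v}}"
    using assms v linked_class_eq[of _ v F] unfolding components_def connected_iff_linked by blast
  then show ?thesis by simp
qed

section \<open>Spanning trees as connected sets of the right size\<close>

text \<open>
  This is acyclicity, phrased through \<open>linked\<close> so that removing and adding edges can be
  analysed without handling cycles; \<open>cycle_edge_not_bridge\<close> and \<open>acyclic_bridges_only\<close> show the
  equivalence.
\<close>

definition bridges_only :: "'e set \<Rightarrow> bool" where
  "bridges_only F \<longleftrightarrow> (\<forall>e\<in>F. \<forall>a b. ends G e = {a, b} \<longrightarrow> (a, b) \<notin> linked (F - {e}))"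

text \<open>
  In such a set every edge, when it is added, joins two different components.
\<close>

lemma bridges_only_card:
  assumes "F \<subseteq> edges G" "bridges_only F"
  shows "card (components F) + card F = card (verts G)"
proof -
  have "finite F" using assms(1) finite_edges finite_subset by blast
  then show ?thesis using assms
  proof (induction F rule: finite_induct)
    case empty then show ?case by (simp add: card_components_empty)
  next
    case (insert e F)
    have "bridges_only F"
      unfolding bridges_only_def
    proof (intro ballI allI impI)
      fix f a b assume "f \<in> F" "ends G f = {a, b}"
      moreover have "linked (F - {f}) \<subseteq> linked (insert e F - {f})"
        by (rule linked_mono) auto
      ultimately show "(a, b) \<notin> linked (F - {f})"
        using insert.prems(2) by (auto simp: bridges_only_def)
    qed
    then have IH: "card (components F) + card F = card (verts G)" using insert by simp
    obtain a b where ab: "ends G e = {a, b}" using insert.prems(1) by (auto elim: edge_ends)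
    then have "(a, b) \<notin> linked F"
      using insert.prems(2) insert.hyps(2) unfolding bridges_only_def
      by (metis Diff_insert_absorb insertI1)
    then show ?case
      using IH card_components_insert[of e a b F] ab insert.prems(1) insert.hyps by simp
  qed
qed

text \<open>
  The other edges of a cycle link the ends of its last edge.
\<close>

lemma cycle_edge_not_bridge:
  assumes F: "F \<subseteq> edges G" and cyc: "is_cycle (G\<lparr>edges := F\<rparr>) vs es"
  shows "\<not> bridges_only F"
proof -
  define n where "n = length vs"
  have n: "n > 0" "length es = n" and dist: "distinct es" and sub: "set es \<subseteq> F"
    and ends: "\<And>i. i < n \<Longrightarrow> ends G (es ! i) = {vs ! i, vs ! (Suc i mod n)}"
    using cyc by (auto simp: is_cycle_def n_def)
  define e where "e = es ! (n - 1)"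
  have e: "e \<in> F" "ends G e = {vs ! (n - 1), vs ! 0}"
    using ends[of "n - 1"] n sub by (auto simp: e_def)
  have "(vs ! 0, vs ! i) \<in> linked (F - {e})" if "i < n" for i
    using that
  proof (induction i)
    case 0 then show ?case by (simp add: linked_refl)
  next
    case (Suc i)
    then have "es ! i \<noteq> e" using dist n by (simp add: e_def nth_eq_iff_index_eq)
    then have "es ! i \<in> F - {e}" using Suc.prems n sub by auto
    then have "(vs ! i, vs ! Suc i) \<in> linked (F - {e})"
      using ends[of i] Suc.prems by (intro linked_edge) auto
    then show ?case using Suc by (auto intro: linked_trans)
  qed
  then have "(vs ! (n - 1), vs ! 0) \<in> linked (F - {e})"
    using n by (auto intro: linked_sym)
  then show ?thesis using e unfolding bridges_only_def by blast
qed

text \<open>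
  A shortest walk visits no vertex twice, since the part between two visits could be cut out.
\<close>

lemma linked_simple_walk:
  assumes "(a, b) \<in> linked F"
  obtains n w where "w 0 = a" "w n = b" "inj_on w {..n}"
    "\<And>i. i < n \<Longrightarrow> (w i, w (Suc i)) \<in> adj (G\<lparr>edges := F\<rparr>)"
proof -
  define R where "R = adj (G\<lparr>edges := F\<rparr>)"
  define n where "n = (LEAST n. (a, b) \<in> R ^^ n)"
  have ex: "\<exists>n. (a, b) \<in> R ^^ n" using assms by (simp add: linked_def R_def rtrancl_power)
  then have "(a, b) \<in> R ^^ n" unfolding n_def by (rule LeastI_ex)
  then obtain w where w: "w 0 = a" "w n = b" "\<And>i. i < n \<Longrightarrow> (w i, w (Suc i)) \<in> R"
    by (auto simp: relpow_fun_conv)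
  have steps: "(w i, w (i + d)) \<in> R ^^ d" if "i + d \<le> n" for i d
    using that
  proof (induction d)
    case (Suc d)
    then have "(w (i + d), w (Suc (i + d))) \<in> R" by (intro w(3)) simp
    then show ?case using Suc by auto
  qed simp
  have "w i \<noteq> w j" if "i < j" "j \<le> n" for i j
  proof
    assume eq: "w i = w j"
    have "(a, w i) \<in> R ^^ i" using steps[of 0 i] w(1) that by simp
    moreover have "(w i, b) \<in> R ^^ (n - j)" using steps[of j "n - j"] w(2) that eq by simp
    ultimately have "(a, b) \<in> R ^^ (i + (n - j))" by (auto simp: relpow_add)
    then have "n \<le> i + (n - j)" unfolding n_def by (rule Least_le)
    then show False using that by simp
  qed
  then have "inj_on w {..n}" by (intro linorder_inj_onI) auto
  with w that show ?thesis by (simp add: R_def)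
qed

text \<open>
  If the ends of \<open>e\<close> are linked without \<open>e\<close>, a simple walk between them closes up with \<open>e\<close> to a cycle.
  Its edges are distinct because their end sets are.
\<close>

lemma acyclic_bridges_only:
  assumes F: "F \<subseteq> edges G" and acyc: "\<nexists>vs es. is_cycle (G\<lparr>edges := F\<rparr>) vs es"
  shows "bridges_only F"
  unfolding bridges_only_def
proof (intro ballI allI impI notI)
  fix e a b assume e: "e \<in> F" and ab: "ends G e = {a, b}" and "(a, b) \<in> linked (F - {e})"
  then obtain n w where w: "w 0 = a" "w n = b" "inj_on w {..n}"
    and adj: "\<And>i. i < n \<Longrightarrow> (w i, w (Suc i)) \<in> adj (G\<lparr>edges := F - {e}\<rparr>)"
    by (metis linked_simple_walk)
  have "\<forall>i. \<exists>f. i < n \<longrightarrow> f \<in> F - {e} \<and> ends G f = {w i, w (Suc i)}"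
    using adj by (auto simp: adj_edges_iff)
  then obtain g where g: "\<And>i. i < n \<Longrightarrow> g i \<in> F - {e} \<and> ends G (g i) = {w i, w (Suc i)}"
    by metis
  have w_eq: "w i = w j \<longleftrightarrow> i = j" if "i \<le> n" "j \<le> n" for i j
    using that w(3) by (auto simp: inj_on_def)
  have "inj_on g {..<n}"
  proof (rule inj_onI)
    fix i j assume ij: "i \<in> {..<n}" "j \<in> {..<n}" "g i = g j"
    then have "{w i, w (Suc i)} = {w j, w (Suc j)}" using g by (metis lessThan_iff)
    then show "i = j" using ij w_eq by (auto simp: doubleton_eq_iff)
  qed
  define vs where "vs = map w [0..<Suc n]"
  define es where "es = map g [0..<n] @ [e]"
  have "is_cycle (G\<lparr>edges := F\<rparr>) vs es"
    unfolding is_cycle_def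
  proof (intro conjI)
    show "distinct vs" using w(3) unfolding vs_def distinct_map
      by (simp add: lessThan_Suc_atMost atLeast0LessThan del: upt_Suc)
    show "distinct es" using \<open>inj_on g {..<n}\<close> g
      by (auto simp: es_def distinct_map atLeast0LessThan)
    show "set es \<subseteq> edges (G\<lparr>edges := F\<rparr>)" using g e by (auto simp: es_def)
    show "\<forall>i<length vs. ends (G\<lparr>edges := F\<rparr>) (es ! i) = {vs ! i, vs ! (Suc i mod length vs)}"
    proof (intro allI impI)
      fix i assume "i < length vs"
      then have "i < n \<or> i = n" by (auto simp: vs_def)
      then show "ends (G\<lparr>edges := F\<rparr>) (es ! i) = {vs ! i, vs ! (Suc i mod length vs)}"
        using g[of i] ab w(1,2)
        by (auto simp: vs_def es_def nth_append insert_commute simp del: upt_Suc)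
    qed
  qed (simp_all add: vs_def es_def)
  with acyc show False by blast
qed

lemma spanning_tree_subset: "\<gamma> \<in> spanning_trees G \<Longrightarrow> \<gamma> \<subseteq> edges G"
  by (simp add: spanning_trees_def)

lemma finite_spanning_trees: "finite (spanning_trees G)"
  by (rule finite_subset[of _ "Pow (edges G)"]) (auto simp: spanning_trees_def finite_edges)

text \<open>
  For a connected set, \<open>bridges_only_card\<close> gives the size from acyclicity. In the other direction, an
  edge that is no bridge could be removed without creating a component, and the remaining \<open>n - 2\<close>
  edges would be too few to connect \<open>n\<close> vertices.
\<close>

lemma spanning_tree_iff:
  "\<gamma> \<in> spanning_trees G \<longleftrightarrow>
     \<gamma> \<subseteq> edges G \<and> connected_graph (G\<lparr>edges := \<gamma>\<rparr>) \<and> Suc (card \<gamma>) = card (verts G)"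
proof (cases "\<gamma> \<subseteq> edges G \<and> connected_graph (G\<lparr>edges := \<gamma>\<rparr>)")
  case True
  then have sub: "\<gamma> \<subseteq> edges G" and con: "connected_graph (G\<lparr>edges := \<gamma>\<rparr>)" by auto
  have "(\<nexists>vs es. is_cycle (G\<lparr>edges := \<gamma>\<rparr>) vs es) \<longleftrightarrow> bridges_only \<gamma>"
    using acyclic_bridges_only[OF sub] cycle_edge_not_bridge[OF sub] by blast
  moreover have "bridges_only \<gamma>" if "Suc (card \<gamma>) = card (verts G)"
    unfolding bridges_only_def
  proof (intro ballI allI impI notI)
    fix e a b assume e: "e \<in> \<gamma>" "ends G e = {a, b}" "(a, b) \<in> linked (\<gamma> - {e})"
    have "card (components (\<gamma> - {e})) = card (components \<gamma>)"
      using card_components_insert[of e a b "\<gamma> - {e}"] e sub by (auto simp: insert_absorb)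
    then have "card (verts G) \<le> 1 + card (\<gamma> - {e})"
      using card_verts_le[of "\<gamma> - {e}"] card_components_connected[OF con] sub by auto
    moreover have "card (\<gamma> - {e}) < card \<gamma>"
      using e sub finite_edges finite_subset by (blast intro: card_Diff1_less)
    ultimately show False using that by simp
  qed
  moreover have "Suc (card \<gamma>) = card (verts G)" if "bridges_only \<gamma>"
    using bridges_only_card[OF sub that] card_components_connected[OF con] by simp
  ultimately show ?thesis using sub con by (auto simp: spanning_trees_def is_tree_def)
qed (auto simp: spanning_trees_def is_tree_def)

text \<open>
  A minimal connected set of edges has only bridges.
\<close>

lemma spanning_tree_exists:
  assumes "connected_graph G"
  shows "spanning_trees G \<noteq> {}"
proof -
  let ?C = "{F. F \<subseteq> edges G \<and> connected_graph (G\<lparr>edges := F\<rparr>)}"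
  have "finite ?C" by (rule finite_subset[of _ "Pow (edges G)"]) (auto simp: finite_edges)
  moreover have "edges G \<in> ?C" using assms by simp
  ultimately obtain F where F: "F \<in> ?C" and min: "\<And>H. H \<in> ?C \<Longrightarrow> H \<subseteq> F \<Longrightarrow> F = H"
    using finite_has_minimal[of ?C] by (metis (no_types, lifting) empty_iff)
  have "bridges_only F"
    unfolding bridges_only_def
  proof (intro ballI allI impI notI)
    fix e a b assume e: "e \<in> F" "ends G e = {a, b}" "(a, b) \<in> linked (F - {e})"
    have "linked F \<subseteq> linked (F - {e})"
    proof (rule linked_subsetI)
      fix f u v assume "f \<in> F" "ends G f = {u, v}"
      then show "(u, v) \<in> linked (F - {e})"
        using e by (cases "f = e") (auto simp: doubleton_eq_iff intro: linked_edge linked_sym)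
    qed
    then have "F - {e} \<in> ?C" using F connected_transfer by auto
    then show False using min[of "F - {e}"] e(1) by auto
  qed
  then have "F \<in> spanning_trees G"
    using F bridges_only_card[of F] card_components_connected[of F] by (simp add: spanning_tree_iff)
  then show ?thesis by blast
qed

text \<open>
  The exchange property. Take a minimal \<open>F\<close> between \<open>\<gamma> \<inter> L\<close> and \<open>\<gamma>\<close> that links the ends of \<open>e\<close>, and let
  \<open>f\<close> be an edge of \<open>F\<close> outside \<open>L\<close>. Then \<open>f\<close> joins the component of \<open>u\<close> in \<open>F - {f}\<close> to that of \<open>v\<close>,
  and \<open>e\<close> does the same, so \<open>e\<close> can replace \<open>f\<close>. Taking the replaced edge outside \<open>L\<close> is what allows
  the weights of \<open>e\<close> and \<open>f\<close> to be compared when \<open>L\<close> collects the light edges.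
\<close>

lemma spanning_tree_exchange:
  assumes "\<gamma> \<in> spanning_trees G" and "e \<in> edges G" "ends G e = {u, v}"
    and "e \<in> L" "(u, v) \<notin> linked (\<gamma> \<inter> L)"
  obtains f where "f \<in> \<gamma> - L" "insert e (\<gamma> - {f}) \<in> spanning_trees G"
proof -
  have sub: "\<gamma> \<subseteq> edges G" and con: "connected_graph (G\<lparr>edges := \<gamma>\<rparr>)"
    and card: "Suc (card \<gamma>) = card (verts G)" using assms(1) by (auto simp: spanning_tree_iff)
  have fin: "finite \<gamma>" using sub finite_edges finite_subset by blast
  let ?C = "{F. \<gamma> \<inter> L \<subseteq> F \<and> F \<subseteq> \<gamma> \<and> (u, v) \<in> linked F}"
  have "u \<in> verts G" "v \<in> verts G"
    using assms(2,3) by (metis edge_ends insertCI insertE singletonD)+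
  then have "\<gamma> \<in> ?C" using con by (simp add: connected_iff_linked)
  moreover have "finite ?C" by (rule finite_subset[of _ "Pow \<gamma>"]) (auto simp: fin)
  ultimately obtain F where F: "F \<in> ?C" and min: "\<And>H. H \<in> ?C \<Longrightarrow> H \<subseteq> F \<Longrightarrow> F = H"
    using finite_has_minimal[of ?C] by (metis (no_types, lifting) empty_iff)
  have "F \<noteq> \<gamma> \<inter> L" using F assms(5) by auto
  then obtain f where f: "f \<in> F" "f \<notin> L" using F by auto
  have nl: "(u, v) \<notin> linked (F - {f})"
    using min[of "F - {f}"] F f by auto
  have "f \<in> edges G" using f F sub by blast
  then obtain a b where ab: "ends G f = {a, b}" by (rule edge_ends)
  let ?H = "F - {f}" and ?\<gamma>' = "insert e (\<gamma> - {f})"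
  have "(u, v) \<in> linked (insert f ?H)" using F f by (simp add: insert_absorb)
  then have "(a, u) \<in> linked ?H \<and> (b, v) \<in> linked ?H \<or> (b, u) \<in> linked ?H \<and> (a, v) \<in> linked ?H"
    using nl unfolding linked_insert[OF ab] by (auto intro: linked_trans linked_sym)
  moreover have "linked ?H \<subseteq> linked ?\<gamma>'" using F by (intro linked_mono) auto
  moreover have "(u, v) \<in> linked ?\<gamma>'" by (rule linked_edge[OF _ assms(3)]) simp
  ultimately have f_linked: "(a, b) \<in> linked ?\<gamma>'"
    by (meson linked_trans linked_sym subsetD)
  have "linked \<gamma> \<subseteq> linked ?\<gamma>'"
  proof (rule linked_subsetI)
    fix g x y assume "g \<in> \<gamma>" "ends G g = {x, y}"
    then show "(x, y) \<in> linked ?\<gamma>'"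
      using ab f_linked by (cases "g = f") (auto simp: doubleton_eq_iff intro: linked_edge linked_sym)
  qed
  then have "connected_graph (G\<lparr>edges := ?\<gamma>'\<rparr>)" by (rule connected_transfer[OF con])
  moreover have "e \<notin> \<gamma>"
    using assms(3-5) by (auto intro: linked_edge)
  then have "card ?\<gamma>' = card \<gamma>"
    using card_Suc_Diff1[OF fin, of f] f(1) F fin by auto
  ultimately have "?\<gamma>' \<in> spanning_trees G"
    using sub assms(2) card by (auto simp: spanning_tree_iff)
  with that f F show ?thesis by blast
qed

end

section \<open>Optimal pmfs\<close>

lemma pmf_of_weights:
  fixes w :: "'a \<Rightarrow> real"
  assumes "finite A" "\<And>x. x \<in> A \<Longrightarrow> 0 \<le> w x" "sum w A = 1"
  obtains p where "set_pmf p \<subseteq> A" "\<And>x. x \<in> A \<Longrightarrow> pmf p x = w x"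
proof -
  define f where "f x = (if x \<in> A then w x else 0)" for x
  have nonneg: "0 \<le> f x" for x using assms(2) by (simp add: f_def)
  have "(\<integral>\<^sup>+x. ennreal (f x) \<partial>count_space UNIV) = (\<Sum>x\<in>A. ennreal (f x))"
    by (rule nn_integral_count_space') (auto simp: f_def assms(1))
  also have "\<dots> = ennreal (sum f A)" using nonneg by simp
  also have "sum f A = 1" using assms(3) by (simp add: f_def)
  finally have prob: "(\<integral>\<^sup>+x. ennreal (f x) \<partial>count_space UNIV) = 1" by simp
  show ?thesis
  proof
    show "set_pmf (embed_pmf f) \<subseteq> A"
      by (auto simp: set_embed_pmf[OF nonneg prob] f_def split: if_splits)
    show "pmf (embed_pmf f) x = w x" if "x \<in> A" for x
      using that by (simp add: pmf_embed_pmf[OF nonneg prob] f_def)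
  qed
qed

context finite_multigraph
begin

lemma edge_usage_indicator:
  "edge_usage G \<mu> e = (\<Sum>\<gamma>\<in>spanning_trees G. of_bool (e \<in> \<gamma>) * pmf \<mu> \<gamma>)"
proof -
  have "edge_usage G \<mu> e = (\<Sum>\<gamma>\<in>spanning_trees G. if e \<in> \<gamma> then pmf \<mu> \<gamma> else 0)"
    unfolding edge_usage_def using finite_spanning_trees by (simp add: sum.inter_filter)
  also have "\<dots> = (\<Sum>\<gamma>\<in>spanning_trees G. of_bool (e \<in> \<gamma>) * pmf \<mu> \<gamma>)"
    by (intro sum.cong) auto
  finally show ?thesis .
qed

lemma sum_pmf_spanning_trees:
  "\<mu> \<in> tree_pmfs G \<Longrightarrow> (\<Sum>\<gamma>\<in>spanning_trees G. pmf \<mu> \<gamma>) = 1"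
  by (rule sum_pmf_eq_1) (auto simp: tree_pmfs_def finite_spanning_trees)

text \<open>
  Both sides are the expected number of edges of \<open>D\<close> in a random tree.
\<close>

lemma sum_edge_usage:
  assumes "finite D"
  shows "(\<Sum>e\<in>D. edge_usage G \<mu> e) = (\<Sum>\<gamma>\<in>spanning_trees G. real (card (\<gamma> \<inter> D)) * pmf \<mu> \<gamma>)"
proof -
  have "(\<Sum>e\<in>D. edge_usage G \<mu> e) =
      (\<Sum>\<gamma>\<in>spanning_trees G. \<Sum>e\<in>D. of_bool (e \<in> \<gamma>) * pmf \<mu> \<gamma>)"
    unfolding edge_usage_indicator by (rule sum.swap)
  also have "\<dots> = (\<Sum>\<gamma>\<in>spanning_trees G. real (card (\<gamma> \<inter> D)) * pmf \<mu> \<gamma>)"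
  proof (rule sum.cong[OF refl])
    fix \<gamma>
    have "(\<Sum>e\<in>D. of_bool (e \<in> \<gamma>) :: real) = real (card (\<gamma> \<inter> D))"
      using assms by (simp add: of_bool_def sum.If_cases Int_commute Collect_mem_eq)
    then show "(\<Sum>e\<in>D. of_bool (e \<in> \<gamma>) * pmf \<mu> \<gamma>) = real (card (\<gamma> \<inter> D)) * pmf \<mu> \<gamma>"
      by (simp flip: sum_distrib_right)
  qed
  finally show ?thesis .
qed

lemma sum_edge_usage_edges:
  assumes "\<mu> \<in> tree_pmfs G"
  shows "(\<Sum>e\<in>edges G. edge_usage G \<mu> e) = real (card (verts G)) - 1"
proof -
  have "real (card (\<gamma> \<inter> edges G)) = real (card (verts G)) - 1" if "\<gamma> \<in> spanning_trees G" for \<gamma>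
    using that unfolding spanning_tree_iff by (simp add: Int_absorb2 flip: of_nat_Suc)
  then have "(\<Sum>e\<in>edges G. edge_usage G \<mu> e) =
      (\<Sum>\<gamma>\<in>spanning_trees G. (real (card (verts G)) - 1) * pmf \<mu> \<gamma>)"
    unfolding sum_edge_usage[OF finite_edges] by (intro sum.cong) auto
  also have "\<dots> = real (card (verts G)) - 1"
    by (simp add: sum_pmf_spanning_trees[OF assms] flip: sum_distrib_left)
  finally show ?thesis .
qed

text \<open>
  A continuous function attains its minimum on the simplex of weights on the finite set of spanning trees.
  Weights are extended by zero to all edge sets, which makes the simplex a closed subset of a product
  of compact sets, so it is compact by Tychonoff's theorem.
\<close>

lemma optimal_pmf_exists:
  assumes "connected_graph G"
  shows "\<exists>\<mu>. optimal_pmf G \<mu>"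
proof -
  let ?T = "spanning_trees G"
  define q :: "('e set \<Rightarrow> real) \<Rightarrow> real" where
    "q w = (\<Sum>\<gamma>\<in>?T. \<Sum>\<gamma>'\<in>?T. real (card (\<gamma> \<inter> \<gamma>')) * w \<gamma> * w \<gamma>')" for w
  define S :: "'e set \<Rightarrow> real set" where "S \<gamma> = (if \<gamma> \<in> ?T then {0..1} else {0})" for \<gamma>
  define K where "K = PiE UNIV S \<inter> {w. sum w ?T = 1}"
  have cont: "continuous_on A (\<lambda>w::'e set \<Rightarrow> real. w \<gamma>)" for A \<gamma>
    by (rule continuous_on_subset[OF continuous_on_product_coordinates]) simp
  have "compactin (product_topology (\<lambda>_. euclidean) UNIV) (PiE UNIV S)"
    unfolding compactin_PiE by (auto simp: S_def)
  then have "compact (PiE UNIV S)" by (simp add: euclidean_product_topology)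
  moreover have "closed {w :: 'e set \<Rightarrow> real. sum w ?T = 1}"
    by (intro closed_Collect_eq continuous_on_sum cont continuous_on_const)
  ultimately have "compact K" unfolding K_def by (rule compact_Int_closed)
  have pmf_K: "pmf \<nu> \<in> K" if "\<nu> \<in> tree_pmfs G" for \<nu>
  proof -
    have "pmf \<nu> \<gamma> = 0" if "\<gamma> \<notin> ?T" for \<gamma>
      using \<open>\<nu> \<in> tree_pmfs G\<close> that by (auto simp: tree_pmfs_def set_pmf_eq)
    then show ?thesis
      using that by (auto simp: K_def S_def sum_pmf_spanning_trees pmf_le_1)
  qed
  obtain \<gamma>0 where "\<gamma>0 \<in> ?T" using spanning_tree_exists[OF assms] by blast
  then have "return_pmf \<gamma>0 \<in> tree_pmfs G" by (simp add: tree_pmfs_def)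
  then have "K \<noteq> {}" using pmf_K by blast
  moreover have "continuous_on K q"
    unfolding q_def by (intro continuous_on_sum continuous_on_mult continuous_on_const cont)
  ultimately obtain w where w: "w \<in> K" and min: "\<And>x. x \<in> K \<Longrightarrow> q w \<le> q x"
    using continuous_attains_inf[OF \<open>compact K\<close>] by blast
  have "0 \<le> w \<gamma>" if "\<gamma> \<in> ?T" for \<gamma>
    using w that unfolding K_def S_def by (auto simp: PiE_iff split: if_splits)
  moreover have "sum w ?T = 1" using w by (simp add: K_def)
  ultimately obtain \<mu> where \<mu>: "set_pmf \<mu> \<subseteq> ?T" "\<And>\<gamma>. \<gamma> \<in> ?T \<Longrightarrow> pmf \<mu> \<gamma> = w \<gamma>"
    using pmf_of_weights[OF finite_spanning_trees] by metis
  have overlap: "expected_overlap G \<nu> = q (pmf \<nu>)" for \<nu>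
    by (simp add: expected_overlap_def q_def)
  have "expected_overlap G \<mu> = q w"
    unfolding overlap q_def using \<mu>(2) by (intro sum.cong) auto
  then have "optimal_pmf G \<mu>"
    using \<mu>(1) min pmf_K by (auto simp: optimal_pmf_def tree_pmfs_def overlap)
  then show ?thesis ..
qed

lemma move_mass:
  assumes \<mu>: "\<mu> \<in> tree_pmfs G" and \<gamma>: "\<gamma> \<in> spanning_trees G" "\<gamma>' \<in> spanning_trees G"
    and t: "0 \<le> t" "t \<le> pmf \<mu> \<gamma>"
  obtains \<nu> where "\<nu> \<in> tree_pmfs G"
    "\<And>e. edge_usage G \<nu> e = edge_usage G \<mu> e + t * (of_bool (e \<in> \<gamma>') - of_bool (e \<in> \<gamma>))"
proof -
  let ?T = "spanning_trees G"
  define w where "w \<delta> = pmf \<mu> \<delta> + t * of_bool (\<delta> = \<gamma>') - t * of_bool (\<delta> = \<gamma>)" for \<delta>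
  have pick: "(\<Sum>\<delta>\<in>?T. h \<delta> * of_bool (\<delta> = \<beta>)) = (h \<beta> :: real)" if "\<beta> \<in> ?T" for h \<beta>
    using that finite_spanning_trees by (simp add: of_bool_def if_distrib cong: if_cong)
  have "0 \<le> w \<delta>" for \<delta>
    using t by (auto simp: w_def of_bool_def)
  moreover have "sum w ?T = 1"
    using pick[OF \<gamma>(1), of "\<lambda>_. t"] pick[OF \<gamma>(2), of "\<lambda>_. t"]
    by (simp add: w_def sum.distrib sum_subtractf sum_pmf_spanning_trees[OF \<mu>])
  ultimately obtain \<nu> where \<nu>: "set_pmf \<nu> \<subseteq> ?T" "\<And>\<delta>. \<delta> \<in> ?T \<Longrightarrow> pmf \<nu> \<delta> = w \<delta>"
    using pmf_of_weights[OF finite_spanning_trees] by metis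
  have "edge_usage G \<nu> e = edge_usage G \<mu> e + t * (of_bool (e \<in> \<gamma>') - of_bool (e \<in> \<gamma>))" for e
  proof -
    have "edge_usage G \<nu> e = (\<Sum>\<delta>\<in>?T. of_bool (e \<in> \<delta>) * pmf \<mu> \<delta>
        + (t * of_bool (e \<in> \<delta>)) * of_bool (\<delta> = \<gamma>') - (t * of_bool (e \<in> \<delta>)) * of_bool (\<delta> = \<gamma>))"
      unfolding edge_usage_indicator by (intro sum.cong) (auto simp: \<nu>(2) w_def)
    also have "\<dots> = edge_usage G \<mu> e + t * of_bool (e \<in> \<gamma>') - t * of_bool (e \<in> \<gamma>)"
      unfolding sum_subtractf sum.distrib pick[OF \<gamma>(1), of "\<lambda>\<delta>. t * of_bool (e \<in> \<delta>)"]
        pick[OF \<gamma>(2), of "\<lambda>\<delta>. t * of_bool (e \<in> \<delta>)"] edge_usage_indicator ..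
    finally show ?thesis by (simp add: right_diff_distrib)
  qed
  with \<nu>(1) that show ?thesis by (simp add: tree_pmfs_def)
qed

text \<open>
  First-order optimality: moving mass \<open>t\<close> from \<open>\<gamma>\<close> to \<open>\<gamma>'\<close> changes the expected overlap by
  \<open>2 t S + t\<^sup>2 Q\<close>, where \<open>S\<close> is the difference of the two tree weights. This is nonnegative for all
  small \<open>t > 0\<close>, so \<open>S \<ge> 0\<close>.
\<close>

lemma optimal_support_minimal:
  assumes opt: "optimal_pmf G \<mu>" and \<gamma>: "\<gamma> \<in> set_pmf \<mu>" and \<gamma>': "\<gamma>' \<in> spanning_trees G"
  shows "(\<Sum>e\<in>\<gamma>. edge_usage G \<mu> e) \<le> (\<Sum>e\<in>\<gamma>'. edge_usage G \<mu> e)"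
proof -
  let ?E = "edges G"
  define \<eta> where "\<eta> = edge_usage G \<mu>"
  define d :: "'e \<Rightarrow> real" where "d e = of_bool (e \<in> \<gamma>') - of_bool (e \<in> \<gamma>)" for e
  define S where "S = (\<Sum>e\<in>?E. \<eta> e * d e)"
  define Q where "Q = (\<Sum>e\<in>?E. (d e)\<^sup>2)"
  have \<mu>: "\<mu> \<in> tree_pmfs G" using opt by (simp add: optimal_pmf_def)
  then have \<gamma>T: "\<gamma> \<in> spanning_trees G" using \<gamma> by (auto simp: tree_pmfs_def)
  have Q: "0 \<le> Q" by (simp add: Q_def sum_nonneg)
  have variation: "0 \<le> 2 * S + t * Q" if t: "0 < t" "t \<le> pmf \<mu> \<gamma>" for t
  proof -
    obtain \<nu> where \<nu>: "\<nu> \<in> tree_pmfs G" "\<And>e. edge_usage G \<nu> e = \<eta> e + t * d e"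
      using move_mass[OF \<mu> \<gamma>T \<gamma>', of t] t unfolding \<eta>_def d_def by (metis less_imp_le)
    have "expected_overlap G \<mu> \<le> expected_overlap G \<nu>"
      using opt \<nu>(1) by (simp add: optimal_pmf_def)
    also have "expected_overlap G \<nu> = (\<Sum>e\<in>?E. (\<eta> e)\<^sup>2 + (2 * t) * (\<eta> e * d e) + t\<^sup>2 * (d e)\<^sup>2)"
      unfolding expected_overlap_eq_sum_squares[OF finite_edges] \<nu>(2)
      by (intro sum.cong refl) (simp add: power2_sum power_mult_distrib)
    also have "\<dots> = expected_overlap G \<mu> + (2 * t) * S + t\<^sup>2 * Q"
      unfolding expected_overlap_eq_sum_squares[OF finite_edges] S_def Q_def sum.distrib
        sum_distrib_left \<eta>_def ..
    finally have "0 \<le> t * (2 * S + t * Q)" by (simp add: power2_eq_square algebra_simps)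
    then show ?thesis using t(1) by (simp add: zero_le_mult_iff)
  qed
  have "0 \<le> S"
  proof (rule ccontr)
    assume "\<not> 0 \<le> S"
    \<comment> \<open>This choice gives \<open>t * Q \<le> - S\<close>, so \<open>2 * S + t * Q\<close> stays negative; adding 1 to \<open>Q\<close>
      avoids division by zero.\<close>
    define t where "t = min (pmf \<mu> \<gamma>) (- S / (Q + 1))"
    have "0 < t" using \<gamma> \<open>\<not> 0 \<le> S\<close> Q by (simp add: t_def pmf_positive divide_neg_pos)
    have "t * Q \<le> t * (Q + 1)" using \<open>0 < t\<close> by simp
    also have "\<dots> \<le> - S / (Q + 1) * (Q + 1)"
      using Q by (intro mult_right_mono) (auto simp: t_def)
    also have "\<dots> = - S" using Q by simp
    finally show False using variation[OF \<open>0 < t\<close>] \<open>\<not> 0 \<le> S\<close> by (simp add: t_def)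
  qed
  have restrict: "(\<Sum>e\<in>?E. \<eta> e * of_bool (e \<in> \<delta>)) = sum \<eta> \<delta>" if "\<delta> \<in> spanning_trees G" for \<delta>
    using spanning_tree_subset[OF that] finite_edges
    by (simp add: of_bool_def if_distrib sum.If_cases Int_absorb1 cong: if_cong)
  have "S = sum \<eta> \<gamma>' - sum \<eta> \<gamma>"
    unfolding S_def d_def right_diff_distrib sum_subtractf restrict[OF \<gamma>'] restrict[OF \<gamma>T] ..
  then show ?thesis using \<open>0 \<le> S\<close> by (simp add: \<eta>_def)
qed

section \<open>Partitions and their cut edges\<close>

text \<open>
  A walk that avoids the cut edges stays in one part, so representatives of different parts are not linked.
\<close>

lemma card_partition_le_components:
  assumes P: "partition_on (verts G) P" and F: "F \<subseteq> edges G" "F \<inter> cut_edges G P = {}"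
  shows "card P \<le> card (components F)"
proof -
  have stay: "y \<in> U" if "(x, y) \<in> linked F" "U \<in> P" "x \<in> U" for x y U
    using that(1) unfolding linked_def
  proof (induction rule: rtrancl_induct)
    case (step y z)
    then obtain e where e: "e \<in> F" "ends G e = {y, z}" by (auto simp: adj_edges_iff)
    then have "z \<in> verts G" using F(1) by (metis edge_ends insertCI insertE singletonD subsetD)
    then obtain W where W: "W \<in> P" "z \<in> W" using P by (auto simp: partition_on_def)
    have "U = W"
    proof (rule ccontr)
      assume "U \<noteq> W"
      then have "e \<in> cut_edges G P"
        using e F(1) W step.IH that(2) unfolding cut_edges_def by blast
      then show False using e F(2) by blast
    qed
    then show ?case using W by simp
  qed (use that in simp)
  have "\<exists>v. v \<in> U" if "U \<in> P" for U
    using P that by (metis partition_on_def all_not_in_conv)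
  then obtain r where r: "\<And>U. U \<in> P \<Longrightarrow> r U \<in> U" by metis
  have "inj_on (\<lambda>U. linked F `` {r U}) P"
  proof (rule inj_onI)
    fix U W assume UW: "U \<in> P" "W \<in> P" "linked F `` {r U} = linked F `` {r W}"
    then have "(r U, r W) \<in> linked F" using linked_refl by auto
    then have "r W \<in> U" using stay UW r by blast
    moreover have "r W \<in> W" using UW(2) by (rule r)
    ultimately show "U = W" using UW(1,2) P by (auto simp: partition_on_def disjoint_def)
  qed
  moreover have "(\<lambda>U. linked F `` {r U}) ` P \<subseteq> components F"
    using r P by (auto simp: components_def partition_on_def)
  ultimately show ?thesis using finite_components by (rule card_inj_on_le)
qed

text \<open>
  Without its cut edges the tree has at least \<open>card P\<close> components; putting them back, one component is
  left, and each edge lowers the count by at most one.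
\<close>

lemma spanning_tree_crosses:
  assumes "partition_on (verts G) P" "\<gamma> \<in> spanning_trees G"
  shows "card P \<le> card (\<gamma> \<inter> cut_edges G P) + 1"
proof -
  have \<gamma>: "\<gamma> \<subseteq> edges G" "card (components \<gamma>) = 1"
    using assms(2) card_components_connected by (auto simp: spanning_tree_iff)
  let ?C = "cut_edges G P"
  have "card P \<le> card (components (\<gamma> - ?C))"
    using assms(1) \<gamma>(1) by (intro card_partition_le_components) auto
  also have "\<dots> \<le> card (components ((\<gamma> - ?C) \<union> (\<gamma> \<inter> ?C))) + card (\<gamma> \<inter> ?C)"
    using \<gamma>(1) by (intro card_components_le_union) auto
  also have "(\<gamma> - ?C) \<union> (\<gamma> \<inter> ?C) = \<gamma>" by blast
  finally show ?thesis using \<gamma>(2) by simp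
qed

section \<open>Homogeneity and the cut bound\<close>

lemma homogeneous_imp_cut_bound:
  assumes E: "edges G \<noteq> {}" and hom: "homogeneous G" and P: "feasible_partition G P"
  shows "real (card (edges G)) / (real (card (verts G)) - 1)
    \<le> real (card (cut_edges G P)) / (real (card P) - 1)"
proof -
  let ?C = "cut_edges G P"
  obtain \<mu> c where \<mu>: "\<mu> \<in> tree_pmfs G" and c: "\<And>e. e \<in> edges G \<Longrightarrow> edge_usage G \<mu> e = c"
    using hom unfolding homogeneous_def optimal_pmf_def by blast
  have part: "partition_on (verts G) P" and k: "2 \<le> card P"
    using P by (auto simp: feasible_partition_def)
  have sub: "?C \<subseteq> edges G" by (auto simp: cut_edges_def)
  have m: "card (edges G) > 0" using E finite_edges by (simp add: card_gt_0_iff)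
  have total: "real (card (edges G)) * c = real (card (verts G)) - 1"
    using sum_edge_usage_edges[OF \<mu>] by (simp add: c)
  have "real (card P) - 1 = (\<Sum>\<gamma>\<in>spanning_trees G. (real (card P) - 1) * pmf \<mu> \<gamma>)"
    by (simp add: sum_pmf_spanning_trees[OF \<mu>] flip: sum_distrib_left)
  also have "\<dots> \<le> (\<Sum>\<gamma>\<in>spanning_trees G. real (card (\<gamma> \<inter> ?C)) * pmf \<mu> \<gamma>)"
    using spanning_tree_crosses[OF part]
    by (intro sum_mono mult_right_mono) (auto simp: algebra_simps simp flip: of_nat_Suc)
  also have "\<dots> = (\<Sum>e\<in>?C. edge_usage G \<mu> e)"
    using sub finite_edges by (intro sum_edge_usage[symmetric]) (rule finite_subset)
  also have "\<dots> = real (card ?C) * c" using c sub by (simp add: subset_iff)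
  finally have cut: "real (card P) - 1 \<le> real (card ?C) * c" .
  then have "0 < real (card ?C) * c" using k by linarith
  then have "0 < c" by (simp add: zero_less_mult_iff)
  have "real (card (edges G)) / (real (card (verts G)) - 1) = 1 / c"
    unfolding total[symmetric] using m by simp
  also have "\<dots> \<le> real (card ?C) / (real (card P) - 1)"
    using cut \<open>0 < c\<close> k by (simp add: field_simps)
  finally show ?thesis .
qed

lemma partition_on_components:
  assumes "F \<subseteq> edges G"
  shows "partition_on (verts G) (components F)"
proof (rule partition_onI)
  show "\<Union> (components F) = verts G"
    using linked_refl linked_verts[OF _ assms] unfolding components_def by blast
  show "disjnt A B" if AB: "A \<in> components F" "B \<in> components F" "A \<noteq> B" for A B
  proof -
    obtain x y where xy: "A = linked F `` {x}" "B = linked F `` {y}"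
      using AB(1,2) by (auto simp: components_def)
    have "A = B" if "z \<in> A" "z \<in> B" for z
      using linked_class_eq[of x z F] linked_class_eq[of y z F] that unfolding xy by simp
    then show ?thesis using AB(3) by (auto simp: disjnt_iff)
  qed
  show "{} \<notin> components F"
    using linked_refl unfolding components_def by blast
qed

text \<open>
  A walk along \<open>F\<close> that starts in a component never leaves it, so it is a walk in the induced subgraph.
\<close>

lemma component_connected:
  assumes F: "F \<subseteq> edges G" and U: "U \<in> components F"
  shows "connected_graph (induced_subgraph G U)"
proof -
  obtain r where r: "r \<in> verts G" "U = linked F `` {r}" using U by (auto simp: components_def)
  have walk: "(x, y) \<in> (adj (induced_subgraph G U))\<^sup>*" if "(x, y) \<in> linked F" "x \<in> U" for x y
  proof -
    have "y \<in> U \<and> (x, y) \<in> (adj (induced_subgraph G U))\<^sup>*"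
      using that(1) unfolding linked_def
    proof (induction rule: rtrancl_induct)
      case base then show ?case using that(2) by simp
    next
      case (step y z)
      then obtain e where e: "e \<in> F" "ends G e = {y, z}" by (auto simp: adj_edges_iff)
      then have "z \<in> U" using step.IH r(2) by (auto intro: linked_trans linked_edge)
      then have "(y, z) \<in> adj (induced_subgraph G U)"
        using e F step.IH by (auto simp: adj_def induced_subgraph_def)
      then show ?case using step.IH \<open>z \<in> U\<close> by auto
    qed
    then show ?thesis by simp
  qed
  have "(x, y) \<in> linked F" if "x \<in> U" "y \<in> U" for x y
    using that unfolding r(2) by (auto intro: linked_trans linked_sym)
  moreover have "r \<in> U" using r linked_refl by simp
  ultimately show ?thesis using walk
    by (auto simp: connected_graph_def induced_subgraph_def)
qed

lemma cut_edges_components: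
  "cut_edges G (components F) \<subseteq> edges G - F"
proof
  fix e assume "e \<in> cut_edges G (components F)"
  then obtain A B u v where e: "e \<in> edges G" "ends G e = {u, v}"
    and AB: "A \<in> components F" "B \<in> components F" "A \<noteq> B" "u \<in> A" "v \<in> B"
    unfolding cut_edges_def by blast
  then obtain x y where "A = linked F `` {x}" "B = linked F `` {y}"
    by (auto simp: components_def)
  with AB have uv: "(x, u) \<in> linked F" "(y, v) \<in> linked F" "linked F `` {x} \<noteq> linked F `` {y}"
    by auto
  have "e \<notin> F"
  proof
    assume "e \<in> F"
    then have "(u, v) \<in> linked F" using e(2) by (rule linked_edge)
    then have "(x, y) \<in> linked F" using uv(1,2) by (meson linked_trans linked_sym)
    then show False using uv(3) linked_class_eq by blast
  qed
  then show "e \<in> edges G - F" using e(1) by simp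
qed

text \<open>
  If the ends of a light edge were not linked by the light edges of \<open>\<gamma>\<close>, the light edge could replace
  an edge of usage at least \<open>M\<close> in \<open>\<gamma>\<close>, which would make a tree in the support lighter.
\<close>

lemma optimal_support_links_light_edges:
  fixes M :: real
  assumes opt: "optimal_pmf G \<mu>" and \<gamma>: "\<gamma> \<in> set_pmf \<mu>"
  defines "L \<equiv> {e \<in> edges G. edge_usage G \<mu> e < M}"
  shows "linked (\<gamma> \<inter> L) = linked L"
proof
  show "linked (\<gamma> \<inter> L) \<subseteq> linked L" by (rule linked_mono) auto
  have \<gamma>T: "\<gamma> \<in> spanning_trees G" using opt \<gamma> by (auto simp: optimal_pmf_def tree_pmfs_def)
  then have sub: "\<gamma> \<subseteq> edges G" by (rule spanning_tree_subset)
  then have fin: "finite \<gamma>" using finite_edges finite_subset by blast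
  show "linked L \<subseteq> linked (\<gamma> \<inter> L)"
  proof (rule linked_subsetI, rule ccontr)
    fix e u v assume e: "e \<in> L" "ends G e = {u, v}" "(u, v) \<notin> linked (\<gamma> \<inter> L)"
    then obtain f where f: "f \<in> \<gamma> - L" "insert e (\<gamma> - {f}) \<in> spanning_trees G"
      using spanning_tree_exchange[OF \<gamma>T _ e(2,1,3)] by (auto simp: L_def)
    have "e \<notin> \<gamma>" using e linked_edge[of e "\<gamma> \<inter> L" u v] by auto
    have "sum (edge_usage G \<mu>) \<gamma> \<le> sum (edge_usage G \<mu>) (insert e (\<gamma> - {f}))"
      by (rule optimal_support_minimal[OF opt \<gamma> f(2)])
    also have "\<dots> = edge_usage G \<mu> e + (sum (edge_usage G \<mu>) \<gamma> - edge_usage G \<mu> f)"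
      using \<open>e \<notin> \<gamma>\<close> f(1) fin by (simp add: sum_diff1)
    finally have "edge_usage G \<mu> f \<le> edge_usage G \<mu> e" by simp
    then show False using e(1) f(1) sub by (auto simp: L_def)
  qed
qed

text \<open>
  Each tree in the support has at least \<open>n - k\<close> edges in \<open>L\<close>, because these link as much as \<open>L\<close> does,
  which has \<open>k\<close> components. This leaves at most \<open>k - 1\<close> edges outside \<open>L\<close>.
\<close>

lemma heavy_edges_usage:
  fixes M :: real
  assumes opt: "optimal_pmf G \<mu>"
  defines "L \<equiv> {e \<in> edges G. edge_usage G \<mu> e < M}"
  shows "(\<Sum>e\<in>edges G - L. edge_usage G \<mu> e) \<le> real (card (components L)) - 1"
proof -
  have \<mu>: "\<mu> \<in> tree_pmfs G" using opt by (simp add: optimal_pmf_def)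
  have "real (card (\<gamma> \<inter> (edges G - L))) * pmf \<mu> \<gamma> \<le> (real (card (components L)) - 1) * pmf \<mu> \<gamma>"
    if \<gamma>T: "\<gamma> \<in> spanning_trees G" for \<gamma>
  proof (cases "\<gamma> \<in> set_pmf \<mu>")
    case True
    have \<gamma>: "\<gamma> \<subseteq> edges G" "Suc (card \<gamma>) = card (verts G)" using \<gamma>T by (auto simp: spanning_tree_iff)
    have "components (\<gamma> \<inter> L) = components L"
      using optimal_support_links_light_edges[OF opt True, of M] unfolding L_def components_def by simp
    then have "card (verts G) \<le> card (components L) + card (\<gamma> \<inter> L)"
      using card_verts_le[of "\<gamma> \<inter> L"] \<gamma>(1) by auto
    moreover have "card \<gamma> = card (\<gamma> \<inter> L) + card (\<gamma> - L)"
      using \<gamma>(1) finite_edges finite_subset by (metis card_Int_Diff)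
    moreover have "\<gamma> \<inter> (edges G - L) = \<gamma> - L" using \<gamma>(1) by blast
    ultimately have "card (\<gamma> \<inter> (edges G - L)) + 1 \<le> card (components L)" using \<gamma>(2) by simp
    then show ?thesis by (intro mult_right_mono) auto
  qed (simp add: set_pmf_eq)
  then have "(\<Sum>e\<in>edges G - L. edge_usage G \<mu> e) \<le>
      (\<Sum>\<gamma>\<in>spanning_trees G. (real (card (components L)) - 1) * pmf \<mu> \<gamma>)"
    unfolding sum_edge_usage[OF finite_Diff[OF finite_edges]] by (rule sum_mono)
  also have "\<dots> = real (card (components L)) - 1"
    by (simp add: sum_pmf_spanning_trees[OF \<mu>] flip: sum_distrib_left)
  finally show ?thesis .
qed

lemma cut_bound_imp_homogeneous:
  assumes con: "connected_graph G" and E: "edges G \<noteq> {}"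
    and bound: "\<And>P. feasible_partition G P \<Longrightarrow>
      real (card (edges G)) / (real (card (verts G)) - 1)
        \<le> real (card (cut_edges G P)) / (real (card P) - 1)"
  shows "homogeneous G"
proof -
  obtain \<mu> where opt: "optimal_pmf G \<mu>" using optimal_pmf_exists[OF con] by blast
  then have \<mu>: "\<mu> \<in> tree_pmfs G" by (simp add: optimal_pmf_def)
  define \<eta> where "\<eta> = edge_usage G \<mu>"
  define M where "M = Max (\<eta> ` edges G)"
  define L where "L = {e \<in> edges G. \<eta> e < M}"
  define P where "P = components L"
  have le_M: "\<eta> e \<le> M" if "e \<in> edges G" for e
    using that finite_edges by (simp add: M_def)
  have "M \<in> \<eta> ` edges G" unfolding M_def using E finite_edges by (intro Max_in) auto
  then have heavy: "edges G - L \<noteq> {}" by (auto simp: L_def)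
  \<comment> \<open>Otherwise the components of \<open>L\<close> form a feasible partition that violates the bound.\<close>
  have "L = {}"
  proof (rule ccontr)
    assume "L \<noteq> {}"
    obtain e a b where "e \<in> edges G" "a \<noteq> b" "a \<in> verts G" "b \<in> verts G"
      using E by (metis ex_in_conv edge_ends)
    then have "card {a, b} \<le> card (verts G)" by (intro card_mono finite_verts) auto
    then have n: "2 \<le> card (verts G)" using \<open>a \<noteq> b\<close> by simp
    have "sum \<eta> (edges G) < (\<Sum>e\<in>edges G. M)"
      using le_M \<open>L \<noteq> {}\<close> by (intro sum_strict_mono_ex1 finite_edges) (auto simp: L_def)
    then have total: "real (card (verts G)) - 1 < M * real (card (edges G))"
      using sum_edge_usage_edges[OF \<mu>] by (simp add: \<eta>_def mult.commute)
    then have "0 < M * real (card (edges G))" using n by linarith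
    then have "0 < M" by (simp add: zero_less_mult_iff)
    have "sum \<eta> (edges G - L) = (\<Sum>e\<in>edges G - L. M)"
      using le_M by (intro sum.cong) (force simp: L_def)+
    then have usage: "M * real (card (edges G - L)) \<le> real (card P) - 1"
      using heavy_edges_usage[OF opt, of M] by (simp add: P_def L_def \<eta>_def mult.commute)
    have "0 < card (edges G - L)" using heavy finite_edges by (simp add: card_gt_0_iff)
    then have "0 < M * real (card (edges G - L))" using \<open>0 < M\<close> by simp
    then have k: "0 < real (card P) - 1" using usage by linarith
    have "L \<subseteq> edges G" by (auto simp: L_def)
    then have "feasible_partition G P"
      using k partition_on_components component_connected
      by (auto simp: feasible_partition_def P_def)
    then have "real (card (edges G)) * (real (card P) - 1)
        \<le> real (card (cut_edges G P)) * (real (card (verts G)) - 1)"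
      using bound[of P] k n by (simp add: divide_simps split: if_splits)
    then have "M * real (card (edges G)) * (real (card P) - 1)
        \<le> M * real (card (cut_edges G P)) * (real (card (verts G)) - 1)"
      using \<open>0 < M\<close> by (simp add: mult.assoc)
    also have "M * real (card (cut_edges G P)) \<le> M * real (card (edges G - L))"
      using \<open>0 < M\<close> cut_edges_components[of L] finite_edges
      by (intro mult_left_mono) (auto simp: P_def intro: card_mono)
    then have "M * real (card (cut_edges G P)) * (real (card (verts G)) - 1)
        \<le> (real (card P) - 1) * (real (card (verts G)) - 1)"
      using usage n by (intro mult_right_mono) auto
    also have "\<dots> < (real (card P) - 1) * (M * real (card (edges G)))"
      using total k by (intro mult_strict_left_mono)
    finally show False by (simp add: mult.commute)
  qed
  then have "\<forall>e\<in>edges G. \<eta> e = M" using le_M by (force simp: L_def)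
  then show ?thesis using opt unfolding homogeneous_def \<eta>_def by blast
qed

end

theorem theorem4p11:
  fixes G :: "('v, 'e) multigraph"
  assumes "finite_loopfree G" and "connected_graph G" and "edges G \<noteq> {}"
  shows "homogeneous G \<longleftrightarrow>
    (\<forall>P. feasible_partition G P \<longrightarrow>
      real (card (cut_edges G P)) / (real (card P) - 1)
        \<ge> real (card (edges G)) / (real (card (verts G)) - 1))"
proof -
  interpret finite_multigraph G using assms(1) by unfold_locales
  show ?thesis
    using homogeneous_imp_cut_bound[OF assms(3)] cut_bound_imp_homogeneous[OF assms(2,3)] by blast
qed

end
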